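(* Let $q\geq4$ be an integer, $n=q^2-1$, and let $A_0=I,A_1,A_2,A_3$ be the adjacency matrices of a symmetric 3-class association scheme on $n$ points with first eigenmatrix \[ P=\begin{bmatrix}1&\frac{q^2}{2}-q&\frac{q^2}{2}&q-2\\ 1&\frac q2&-\frac q2&-1\\ 1&-\frac q2+1&-\frac q2&q-2\\ 1&-\frac q2&\frac q2&-1\end{bmatrix}. \] Let $w_1,w_2,w_3$ be nonzero complex numbers. Then $W=A_0+w_1A_1+w_2A_2+w_3A_3$ is a type-II matrix if and only if one of the following holds: (i) $w_1=w_2=w_3$ and $w_3+\frac1{w_3}+q^2-3=0$; (ii) $w_3+\frac1{w_3}+q^2-3=0$ and $w_1=w_2=\frac{-(q-3)w_3+(q-1)}{q^2-2q-1}$; (iii) $w_1+\frac1{w_1}=\frac{2(q^2-6)}{q^2-4}$, $w_2=-1$, $w_3=w_1$; (iv) $w_1=w_3=1$ and $w_2+\frac1{w_2}=\frac{-2(q^2-2)}{q^2}$; (v) $w_1+\frac1{w_1}=-\frac2q$, $w_2=\frac1{w_1}$, $w_3=1$; (vi) for some real number $r$ with $r^2=(17q-1)(q-1)$, setting \[ a_{0,1}=\frac{-(q-1)(q-2)+(q+2)r}{2q(q+1)},\quad a_{0,2}=\frac{(q+2)(q-1)-(q-2)r}{2q(q-3)},\quad a_{0,3}=\frac{5q^2-2q-19-(q-1)r}{2(q+1)(q-3)}, \] \[ a_{1,2}=\frac{2(-q^4+2q^3+4q^2-10q+1+(q-1)r)}{q^2(q+1)(q-3)},\quad a_{1,3}=-a_{0,2},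 \] one has $w_1+\frac1{w_1}=a_{0,1}$ and $w_i=\frac{w_1^2-1}{a_{1,i}w_1-a_{0,i}}$ for $i=2,3$. Moreover, in case (vi), $w_1w_2=-w_3$ holds.
   Context: A symmetric association scheme with adjacency matrices $A_0=I,A_1,\dots,A_d$: the $A_i$ are symmetric $n\times n$ $(0,1)$-matrices summing to the all-ones matrix $J$, whose span (the Bose--Mesner algebra) is closed under multiplication; it has primitive idempotents $E_0=\frac1nJ,E_1,\dots,E_d$, and the first eigenmatrix $P=(P_{i,j})$ is defined by $A_j=\sum_iP_{i,j}E_i$. A type-II matrix is an $n\times n$ matrix $W$ with nonzero complex entries such that $W(W^{(-)})^\top=nI$, where $W^{(-)}$ is the entrywise inverse of $W$. *)

theory Defs
  imports "Jordan_Normal_Form.Matrix"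
begin

definition lin_comb :: "nat \<Rightarrow> nat \<Rightarrow> (nat \<Rightarrow> complex) \<Rightarrow> (nat \<Rightarrow> complex mat) \<Rightarrow> complex mat" where
  "lin_comb n d c M = mat n n (\<lambda>(a,b). \<Sum>k\<le>d. c k * M k $$ (a,b))"

definition all_ones :: "nat \<Rightarrow> complex mat" where
  "all_ones n = mat n n (\<lambda>_. 1)"

definition sym_assoc_scheme :: "nat \<Rightarrow> nat \<Rightarrow> (nat \<Rightarrow> complex mat) \<Rightarrow> bool" where
  "sym_assoc_scheme n d A \<longleftrightarrow>
     n \<ge> 1 \<and>
     (\<forall>i\<le>d. A i \<in> carrier_mat n n) \<and>
     A 0 = 1\<^sub>m n \<and>
     (\<forall>i\<le>d. \<forall>a<n. \<forall>b<n. A i $$ (a,b) = 0 \<or> A i $$ (a,b) = 1) \<and>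
     (\<forall>i\<le>d. A i \<noteq> 0\<^sub>m n n) \<and>
     (\<forall>i\<le>d. transpose_mat (A i) = A i) \<and>
     lin_comb n d (\<lambda>_. 1) A = all_ones n \<and>
     (\<forall>i\<le>d. \<forall>j\<le>d. \<exists>p. A i * A j = lin_comb n d p A)"

text \<open>P is the first eigenmatrix of the scheme: there are primitive idempotents
  E 0 = J/n, E 1, ..., E d of the Bose--Mesner algebra with A j = sum_i P i j E i.
  Primitive idempotents: d+1 nonzero, pairwise orthogonal idempotents of the
  (d+1)-dimensional Bose--Mesner algebra summing to I.\<close>
definition first_eigenmatrix :: "nat \<Rightarrow> nat \<Rightarrow> (nat \<Rightarrow> complex mat) \<Rightarrow> (nat \<Rightarrow> nat \<Rightarrow> complex) \<Rightarrow> bool" where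
  "first_eigenmatrix n d A P \<longleftrightarrow>
     (\<exists>E :: nat \<Rightarrow> complex mat.
        (\<forall>i\<le>d. E i \<in> carrier_mat n n) \<and>
        E 0 = (1 / of_nat n) \<cdot>\<^sub>m all_ones n \<and>
        (\<forall>i\<le>d. E i \<noteq> 0\<^sub>m n n) \<and>
        (\<forall>i\<le>d. \<exists>c. E i = lin_comb n d c A) \<and>
        (\<forall>i\<le>d. \<forall>j\<le>d. E i * E j = (if i = j then E i else 0\<^sub>m n n)) \<and>
        lin_comb n d (\<lambda>_. 1) E = 1\<^sub>m n \<and>
        (\<forall>j\<le>d. A j = lin_comb n d (\<lambda>i. P i j) E))"

definition entry_inv :: "complex mat \<Rightarrow> complex mat" where
  "entry_inv W = mat (dim_row W) (dim_col W) (\<lambda>ij. inverse (W $$ ij))"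

definition type_II :: "nat \<Rightarrow> complex mat \<Rightarrow> bool" where
  "type_II n W \<longleftrightarrow> W \<in> carrier_mat n n \<and>
     (\<forall>a<n. \<forall>b<n. W $$ (a,b) \<noteq> 0) \<and>
     W * transpose_mat (entry_inv W) = of_nat n \<cdot>\<^sub>m 1\<^sub>m n"

definition P_thm :: "nat \<Rightarrow> nat \<Rightarrow> nat \<Rightarrow> complex" where
  "P_thm q i j = (let x = (of_nat q :: complex) in
     [[1, x^2/2 - x, x^2/2, x - 2],
      [1, x/2, - x/2, -1],
      [1, - x/2 + 1, - x/2, x - 2],
      [1, - x/2, x/2, -1]] ! i ! j)"

end

theory Submission
  imports Defs
begin

text \<open>In the basis of primitive idempotents, \<open>W\<close> is type-II iff
  \<open>(\<Sum>\<^sub>j P\<^sub>i\<^sub>j w\<^sub>j) (\<Sum>\<^sub>j P\<^sub>i\<^sub>j / w\<^sub>j) = n\<close> for every \<open>i\<close>. Rows 1 and 3 of \<open>P\<close> differ only in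
  the sign of two entries, and subtracting their equations gives
  \<open>(w\<^sub>1 - w\<^sub>2) (w\<^sub>3 - 1) (w\<^sub>1 w\<^sub>2 + w\<^sub>3) = 0\<close>. The component \<open>w\<^sub>1 = w\<^sub>2\<close> yields (i) and (ii),
  the component \<open>w\<^sub>3 = 1\<close> yields (iv) and (v). On \<open>w\<^sub>3 = - w\<^sub>1 w\<^sub>2\<close> the difference of the two
  remaining equations has the factor \<open>w\<^sub>2 + 1\<close>, which gives (iii), and a factor linear in \<open>w\<^sub>2\<close>;
  eliminating \<open>w\<^sub>2\<close> with the latter leaves a palindromic quartic in \<open>w\<^sub>1\<close> that splits into two
  palindromic quadratics over the square root of \<open>(17q - 1)(q - 1)\<close>, which is (vi).\<close>

section \<open>Linear combinations of matrices\<close>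

lemma lin_comb_carrier [simp]: "lin_comb n d c M \<in> carrier_mat n n"
  by (simp add: lin_comb_def)

lemma dim_lin_comb [simp]: "dim_row (lin_comb n d c M) = n" "dim_col (lin_comb n d c M) = n"
  by (simp_all add: lin_comb_def)

lemma index_lin_comb [simp]:
  "a < n \<Longrightarrow> b < n \<Longrightarrow> lin_comb n d c M $$ (a, b) = (\<Sum>k\<le>d. c k * M k $$ (a, b))"
  by (simp add: lin_comb_def)

lemma lin_comb_mult_left:
  assumes E: "\<And>k. k \<le> d \<Longrightarrow> E k \<in> carrier_mat n n" and B: "B \<in> carrier_mat n n"
  shows "lin_comb n d c E * B = lin_comb n d c (\<lambda>k. E k * B)"
proof (rule eq_matI)
  fix a b assume "a < dim_row (lin_comb n d c (\<lambda>k. E k * B))" "b < dim_col (lin_comb n d c (\<lambda>k. E k * B))"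
  then have ab: "a < n" "b < n" by auto
  have EB: "(E k * B) $$ (a, b) = (\<Sum>i<n. E k $$ (a, i) * B $$ (i, b))" if "k \<le> d" for k
    using ab E[OF that] B by (auto simp: scalar_prod_def lessThan_atLeast0)
  have "(lin_comb n d c E * B) $$ (a, b) = (\<Sum>i<n. (\<Sum>k\<le>d. c k * E k $$ (a, i)) * B $$ (i, b))"
    using ab B by (auto simp: scalar_prod_def lessThan_atLeast0 intro!: sum.cong)
  also have "\<dots> = (\<Sum>k\<le>d. c k * (\<Sum>i<n. E k $$ (a, i) * B $$ (i, b)))"
    unfolding sum_distrib_right sum_distrib_left by (subst sum.swap) (simp add: mult.assoc)
  also have "\<dots> = lin_comb n d c (\<lambda>k. E k * B) $$ (a, b)"
    using ab by (simp add: EB)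
  finally show "(lin_comb n d c E * B) $$ (a, b) = lin_comb n d c (\<lambda>k. E k * B) $$ (a, b)" .
qed (use B in auto)

lemma lin_comb_cong:
  assumes "\<And>k. k \<le> d \<Longrightarrow> c k \<cdot>\<^sub>m M k = c' k \<cdot>\<^sub>m M' k"
    and "\<And>k. k \<le> d \<Longrightarrow> M k \<in> carrier_mat n n" "\<And>k. k \<le> d \<Longrightarrow> M' k \<in> carrier_mat n n"
  shows "lin_comb n d c M = lin_comb n d c' M'"
proof (rule eq_matI)
  fix a b assume "a < dim_row (lin_comb n d c' M')" "b < dim_col (lin_comb n d c' M')"
  then have ab: "a < n" "b < n" by auto
  have "c k * M k $$ (a, b) = c' k * M' k $$ (a, b)" if "k \<le> d" for k
  proof -
    have "(c k \<cdot>\<^sub>m M k) $$ (a, b) = (c' k \<cdot>\<^sub>m M' k) $$ (a, b)" using assms(1)[OF that] by simp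
    then show ?thesis using ab assms(2,3)[OF that] by auto
  qed
  then show "lin_comb n d c M $$ (a, b) = lin_comb n d c' M' $$ (a, b)" using ab by simp
qed auto

lemma lin_comb_comp:
  assumes "\<And>j. j \<le> d \<Longrightarrow> A j = lin_comb n d (\<lambda>i. P i j) E"
  shows "lin_comb n d c A = lin_comb n d (\<lambda>i. \<Sum>j\<le>d. c j * P i j) E"
proof (rule eq_matI)
  fix a b assume "a < dim_row (lin_comb n d (\<lambda>i. \<Sum>j\<le>d. c j * P i j) E)"
    "b < dim_col (lin_comb n d (\<lambda>i. \<Sum>j\<le>d. c j * P i j) E)"
  then have ab: "a < n" "b < n" by auto
  have "lin_comb n d c A $$ (a, b) = (\<Sum>j\<le>d. c j * (\<Sum>i\<le>d. P i j * E i $$ (a, b)))"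
    using ab assms by simp
  also have "\<dots> = (\<Sum>i\<le>d. (\<Sum>j\<le>d. c j * P i j) * E i $$ (a, b))"
    unfolding sum_distrib_right sum_distrib_left by (subst sum.swap) (simp add: mult.assoc)
  finally show "lin_comb n d c A $$ (a, b) = lin_comb n d (\<lambda>i. \<Sum>j\<le>d. c j * P i j) E $$ (a, b)"
    using ab by simp
qed auto

section \<open>The algebra spanned by orthogonal idempotents\<close>

context
  fixes n d :: nat and E :: "nat \<Rightarrow> complex mat"
  assumes E_carrier: "\<And>i. i \<le> d \<Longrightarrow> E i \<in> carrier_mat n n"
    and E_nonzero: "\<And>i. i \<le> d \<Longrightarrow> E i \<noteq> 0\<^sub>m n n"
    and E_orth: "\<And>i j. i \<le> d \<Longrightarrow> j \<le> d \<Longrightarrow> E i * E j = (if i = j then E i else 0\<^sub>m n n)"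
    and E_sum: "lin_comb n d (\<lambda>_. 1) E = 1\<^sub>m n"
begin

lemma lin_comb_mult_idempotent:
  assumes j: "j \<le> d"
  shows "lin_comb n d c E * E j = c j \<cdot>\<^sub>m E j"
proof -
  have "lin_comb n d c E * E j = lin_comb n d c (\<lambda>k. E k * E j)"
    by (rule lin_comb_mult_left) (use E_carrier j in auto)
  also have "\<dots> = c j \<cdot>\<^sub>m E j"
  proof (rule eq_matI)
    fix a b assume "a < dim_row (c j \<cdot>\<^sub>m E j)" "b < dim_col (c j \<cdot>\<^sub>m E j)"
    then have ab: "a < n" "b < n" using E_carrier[OF j] by auto
    have "(\<Sum>k\<le>d. c k * (E k * E j) $$ (a, b)) = (\<Sum>k\<le>d. if k = j then c j * E j $$ (a, b) else 0)"
      using ab j by (intro sum.cong) (auto simp: E_orth simp del: index_mult_mat)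
    then show "lin_comb n d c (\<lambda>k. E k * E j) $$ (a, b) = (c j \<cdot>\<^sub>m E j) $$ (a, b)"
      using ab j E_carrier[OF j] by (simp del: index_mult_mat)
  qed (use E_carrier[OF j] in auto)
  finally show ?thesis .
qed

text \<open>Multiplying by \<open>E i\<close> isolates the coefficient \<open>c i\<close>, and a
  nonzero entry of \<open>E i\<close> lets it be cancelled.\<close>

lemma lin_comb_eq_iff:
  "lin_comb n d c E = lin_comb n d c' E \<longleftrightarrow> (\<forall>i\<le>d. c i = c' i)"
proof
  assume eq: "lin_comb n d c E = lin_comb n d c' E"
  show "\<forall>i\<le>d. c i = c' i"
  proof (intro allI impI)
    fix i assume i: "i \<le> d"
    obtain a b where ab: "a < n" "b < n" "E i $$ (a, b) \<noteq> 0"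
      using E_nonzero[OF i] E_carrier[OF i] by (metis carrier_matD eq_matI index_zero_mat)
    have "c i \<cdot>\<^sub>m E i = c' i \<cdot>\<^sub>m E i"
      using lin_comb_mult_idempotent[OF i, of c] lin_comb_mult_idempotent[OF i, of c'] eq by simp
    then have "(c i \<cdot>\<^sub>m E i) $$ (a, b) = (c' i \<cdot>\<^sub>m E i) $$ (a, b)" by simp
    then show "c i = c' i" using ab E_carrier[OF i] by simp
  qed
next
  assume "\<forall>i\<le>d. c i = c' i"
  then show "lin_comb n d c E = lin_comb n d c' E"
    by (intro lin_comb_cong) (auto simp: E_carrier)
qed

text \<open>The product acts on each \<open>E j\<close> as the scalar \<open>c j * c' j\<close>;
  since the \<open>E j\<close> add up to the identity, these actions determine it.\<close>

lemma lin_comb_mult_lin_comb: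
  "lin_comb n d c E * lin_comb n d c' E = lin_comb n d (\<lambda>i. c i * c' i) E"
proof -
  let ?X = "lin_comb n d c E" and ?Y = "lin_comb n d c' E"
  have assoc: "(?X * ?Y) * E j = (c j * c' j) \<cdot>\<^sub>m E j" if j: "j \<le> d" for j
  proof -
    have "(?X * ?Y) * E j = ?X * (?Y * E j)"
      by (rule assoc_mult_mat) (use E_carrier j in auto)
    also have "\<dots> = c' j \<cdot>\<^sub>m (?X * E j)"
      using lin_comb_mult_idempotent[OF j, of c'] mult_smult_distrib[OF lin_comb_carrier E_carrier[OF j]] by simp
    also have "\<dots> = (c j * c' j) \<cdot>\<^sub>m E j"
      using lin_comb_mult_idempotent[OF j] by (auto intro!: eq_matI)
    finally show ?thesis .
  qed
  have right: "Z * 1\<^sub>m n = lin_comb n d (\<lambda>_. 1) (\<lambda>k. Z * E k)" if Z: "Z \<in> carrier_mat n n" for Z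
  proof (rule eq_matI)
    fix a b assume "a < dim_row (lin_comb n d (\<lambda>_. 1) (\<lambda>k. Z * E k))"
      "b < dim_col (lin_comb n d (\<lambda>_. 1) (\<lambda>k. Z * E k))"
    then have ab: "a < n" "b < n" by auto
    have ZE: "(Z * E k) $$ (a, b) = (\<Sum>i<n. Z $$ (a, i) * E k $$ (i, b))" if "k \<le> d" for k
      using ab Z E_carrier[OF that] by (auto simp: scalar_prod_def lessThan_atLeast0)
    have "(Z * lin_comb n d (\<lambda>_. 1) E) $$ (a, b) = (\<Sum>i<n. Z $$ (a, i) * (\<Sum>k\<le>d. E k $$ (i, b)))"
      using ab Z by (auto simp: scalar_prod_def lessThan_atLeast0 intro!: sum.cong)
    also have "\<dots> = (\<Sum>k\<le>d. \<Sum>i<n. Z $$ (a, i) * E k $$ (i, b))"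
      unfolding sum_distrib_left by (rule sum.swap)
    finally show "(Z * 1\<^sub>m n) $$ (a, b) = lin_comb n d (\<lambda>_. 1) (\<lambda>k. Z * E k) $$ (a, b)"
      using ab ZE E_sum by simp
  qed (use Z in auto)
  have "?X * ?Y = ?X * ?Y * 1\<^sub>m n"
    by (metis right_mult_one_mat lin_comb_carrier mult_carrier_mat)
  also have "\<dots> = lin_comb n d (\<lambda>_. 1) (\<lambda>k. ?X * ?Y * E k)"
    by (rule right) (rule mult_carrier_mat, auto)
  also have "\<dots> = lin_comb n d (\<lambda>i. c i * c' i) E"
    by (rule lin_comb_cong) (auto simp: assoc E_carrier simp del: assoc_mult_mat)
  finally show ?thesis .
qed

end

section \<open>The type-II condition in terms of eigenvalues\<close>

text \<open>Used on the entries of \<open>A 0, ..., A d\<close> at one position, to see that exactly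
  one relation holds there. The sum counts the ones.\<close>

lemma sum_eq_one_unique:
  fixes f :: "nat \<Rightarrow> complex"
  assumes f01: "\<And>i. i \<le> d \<Longrightarrow> f i = 0 \<or> f i = 1" and s: "(\<Sum>i\<le>d. f i) = 1"
  obtains k where "k \<le> d" "\<And>i. i \<le> d \<Longrightarrow> f i = (if i = k then 1 else 0)"
proof -
  have "(\<Sum>i\<le>d. f i) = (\<Sum>i\<le>d. if i \<in> {i. i \<le> d \<and> f i = 1} then 1 else 0)"
    using f01 by (intro sum.cong) auto
  also have "\<dots> = of_nat (card {i. i \<le> d \<and> f i = 1})"
    by (subst sum.inter_restrict[symmetric]) (auto intro!: arg_cong[where f = card])
  finally have "card {i. i \<le> d \<and> f i = 1} = 1" using s by (metis of_nat_eq_1_iff)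
  then obtain k where "{i. i \<le> d \<and> f i = 1} = {k}" by (auto simp: card_1_singleton_iff)
  then have "k \<le> d" "\<And>i. i \<le> d \<Longrightarrow> f i = (if i = k then 1 else 0)" using f01 by auto
  then show ?thesis by (rule that)
qed

text \<open>Each position lies in exactly one relation, so inverting the entries of the matrix
  inverts its coefficients, and symmetry of the \<open>A i\<close> absorbs the transpose. Both
  factors then lie in the Bose--Mesner algebra, where the product is taken eigenvalue by
  eigenvalue.\<close>

lemma type_II_lin_comb_iff:
  assumes scheme: "sym_assoc_scheme n d A" and eig: "first_eigenmatrix n d A P"
    and w: "\<And>i. i \<le> d \<Longrightarrow> w i \<noteq> 0"
  shows "type_II n (lin_comb n d w A) \<longleftrightarrow>
    (\<forall>i\<le>d. (\<Sum>j\<le>d. w j * P i j) * (\<Sum>j\<le>d. inverse (w j) * P i j) = of_nat n)"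
proof -
  obtain E where E: "\<And>i. i \<le> d \<Longrightarrow> E i \<in> carrier_mat n n"
      "\<And>i. i \<le> d \<Longrightarrow> E i \<noteq> 0\<^sub>m n n"
      "\<And>i j. i \<le> d \<Longrightarrow> j \<le> d \<Longrightarrow> E i * E j = (if i = j then E i else 0\<^sub>m n n)"
      "lin_comb n d (\<lambda>_. 1) E = 1\<^sub>m n"
    and AE: "\<And>j. j \<le> d \<Longrightarrow> A j = lin_comb n d (\<lambda>i. P i j) E"
    using eig unfolding first_eigenmatrix_def by blast
  have A01: "A i $$ (a, b) = 0 \<or> A i $$ (a, b) = 1" if "i \<le> d" "a < n" "b < n" for i a b
    using scheme that unfolding sym_assoc_scheme_def by blast
  have A_sym: "A i $$ (a, b) = A i $$ (b, a)" if "i \<le> d" "a < n" "b < n" for i a b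
    using scheme that unfolding sym_assoc_scheme_def by (metis carrier_matD index_transpose_mat(1))
  have A_sum: "(\<Sum>i\<le>d. A i $$ (a, b)) = 1" if "a < n" "b < n" for a b
  proof -
    have "lin_comb n d (\<lambda>_. 1) A $$ (a, b) = all_ones n $$ (a, b)"
      using scheme unfolding sym_assoc_scheme_def by simp
    then show ?thesis using that by (simp add: all_ones_def)
  qed
  \<comment> \<open>The index \<open>k\<close> is chosen before \<open>c\<close>, so two
    combinations with different coefficients select the same index at a given position.\<close>
  have entry: "\<exists>k\<le>d. \<forall>c. lin_comb n d c A $$ (a, b) = c k" if ab: "a < n" "b < n" for a b
  proof -
    obtain k where k: "k \<le> d" "\<And>i. i \<le> d \<Longrightarrow> A i $$ (a, b) = (if i = k then 1 else 0)"
      using sum_eq_one_unique[of d "\<lambda>i. A i $$ (a, b)"] A01 A_sum ab by blast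
    have "lin_comb n d c A $$ (a, b) = c k" for c
    proof -
      have "(\<Sum>i\<le>d. c i * A i $$ (a, b)) = (\<Sum>i\<le>d. if i = k then c k else 0)"
        using k by (intro sum.cong) auto
      then show ?thesis using ab k(1) by simp
    qed
    then show ?thesis using k(1) by blast
  qed
  have comp: "lin_comb n d c A = lin_comb n d (\<lambda>i. \<Sum>j\<le>d. c j * P i j) E" for c
    by (rule lin_comb_comp) (rule AE)
  let ?W = "lin_comb n d w A" and ?V = "lin_comb n d (\<lambda>i. inverse (w i)) A"
  have nz: "?W $$ (a, b) \<noteq> 0" if "a < n" "b < n" for a b
    using entry[OF that] w by metis
  have inv: "inverse (?W $$ (a, b)) = ?V $$ (a, b)" if "a < n" "b < n" for a b
    using entry[OF that] by metis
  have "transpose_mat (entry_inv ?W) = ?V"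
  proof (rule eq_matI)
    fix a b assume "a < dim_row ?V" "b < dim_col ?V"
    then have ab: "a < n" "b < n" by auto
    have "transpose_mat (entry_inv ?W) $$ (a, b) = inverse (?W $$ (b, a))"
      using ab by (simp add: entry_inv_def del: index_lin_comb)
    also have "\<dots> = ?V $$ (b, a)" using inv ab by blast
    also have "\<dots> = ?V $$ (a, b)" using ab A_sym by simp
    finally show "transpose_mat (entry_inv ?W) $$ (a, b) = ?V $$ (a, b)" .
  qed (auto simp: entry_inv_def)
  then have "type_II n ?W \<longleftrightarrow> ?W * ?V = of_nat n \<cdot>\<^sub>m 1\<^sub>m n"
    unfolding type_II_def using nz by auto
  also have "?W * ?V = lin_comb n d
      (\<lambda>i. (\<Sum>j\<le>d. w j * P i j) * (\<Sum>j\<le>d. inverse (w j) * P i j)) E"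
    unfolding comp by (rule lin_comb_mult_lin_comb[OF E])
  also have "of_nat n \<cdot>\<^sub>m 1\<^sub>m n = lin_comb n d (\<lambda>_. of_nat n) E"
    unfolding E(4)[symmetric] by (rule eq_matI) (auto simp: sum_distrib_left)
  also have "lin_comb n d (\<lambda>i. (\<Sum>j\<le>d. w j * P i j) * (\<Sum>j\<le>d. inverse (w j) * P i j)) E
        = lin_comb n d (\<lambda>_. of_nat n) E \<longleftrightarrow>
      (\<forall>i\<le>d. (\<Sum>j\<le>d. w j * P i j) * (\<Sum>j\<le>d. inverse (w j) * P i j) = of_nat n)"
    by (rule lin_comb_eq_iff[OF E])
  finally show ?thesis .
qed

section \<open>Reduction to two polynomial equations\<close>

text \<open>\<open>R1\<close> and \<open>R3\<close> are \<open>S + T\<close> and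
  \<open>S - T\<close>, so both have the required value iff \<open>S\<close> has it and
  \<open>T = 0\<close>; up to nonzero factors, \<open>T\<close> is
  \<open>(a - b) * (c - 1) * (a * b + c)\<close>. Inverses are separate variables, which keeps the
  identities polynomial.\<close>

lemma eigenvalue_equations_iff:
  fixes x a b c a' b' c' :: complex
  assumes "x \<noteq> 0" and inv: "a * a' = 1" "b * b' = 1" "c * c' = 1"
  defines "R0 \<equiv> (1 + (x\<^sup>2/2 - x) * a + x\<^sup>2/2 * b + (x - 2) * c)
                 * (1 + (x\<^sup>2/2 - x) * a' + x\<^sup>2/2 * b' + (x - 2) * c')"
    and "R1 \<equiv> (1 + x/2 * a - x/2 * b - c) * (1 + x/2 * a' - x/2 * b' - c')"
    and "R2 \<equiv> (1 + (1 - x/2) * a - x/2 * b + (x - 2) * c)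
                 * (1 + (1 - x/2) * a' - x/2 * b' + (x - 2) * c')"
    and "R3 \<equiv> (1 - x/2 * a + x/2 * b - c) * (1 - x/2 * a' + x/2 * b' - c')"
  shows "R0 = x\<^sup>2 - 1 \<and> R1 = x\<^sup>2 - 1 \<and> R2 = x\<^sup>2 - 1 \<and> R3 = x\<^sup>2 - 1 \<longleftrightarrow>
    R2 = x\<^sup>2 - 1 \<and> (1 - c) * (1 - c') + x\<^sup>2/4 * (a - b) * (a' - b') = x\<^sup>2 - 1
    \<and> (a = b \<or> c = 1 \<or> c = - (a * b))"
proof -
  define S where "S = (1 - c) * (1 - c') + x\<^sup>2/4 * (a - b) * (a' - b')"
  define T where "T = x/2 * ((a - b) * (1 - c') + (a' - b') * (1 - c))"
  \<comment> \<open>The weights are twice the multiplicities \<open>1, (x - 2)(x + 1)/2, x, (x - 2)(x + 1)/2\<close> of the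
    eigenspaces; they annihilate all mixed terms, so the equation of row 0 is redundant.\<close>
  have "2 * R0 + (x - 2) * (x + 1) * R1 + 2 * x * R2 + (x - 2) * (x + 1) * R3
    = 2 * (x\<^sup>2 - 1) * (1 + (x\<^sup>2/2 - x) * (a * a') + x\<^sup>2/2 * (b * b') + (x - 2) * (c * c'))"
    unfolding R0_def R1_def R2_def R3_def by (simp add: field_simps power2_eq_square)
  then have trace: "2 * R0 + (x - 2) * (x + 1) * R1 + 2 * x * R2 + (x - 2) * (x + 1) * R3 = 2 * (x\<^sup>2 - 1)\<^sup>2"
    unfolding inv by (simp add: algebra_simps power2_eq_square)
  have R1: "R1 = S + T" and R3: "R3 = S - T"
    unfolding R1_def R3_def S_def T_def by (simp_all add: field_simps power2_eq_square)
  \<comment> \<open>The terms are grouped so that primed variables occur only in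
    \<open>a * a'\<close>, \<open>b * b'\<close> and \<open>c * c'\<close>, which \<open>inv\<close>
    then replaces by 1.\<close>
  have "c * (a * b) * ((a - b) * (1 - c') + (a' - b') * (1 - c))
    = (a - b) * a * b * (c - c * c') + c * (b * (a * a') - a * (b * b')) * (1 - c)"
    by (simp add: algebra_simps)
  then have "c * (a * b) * ((a - b) * (1 - c') + (a' - b') * (1 - c)) = (a - b) * (c - 1) * (a * b + c)"
    unfolding inv by (simp add: algebra_simps)
  moreover have "a \<noteq> 0" "b \<noteq> 0" "c \<noteq> 0" using inv by auto
  ultimately have T: "T = 0 \<longleftrightarrow> a = b \<or> c = 1 \<or> c = - (a * b)"
    unfolding T_def using \<open>x \<noteq> 0\<close>
    by (smt (verit) add_eq_0_iff divide_eq_0_iff eq_iff_diff_eq_0 mult_eq_0_iff zero_neq_numeral)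
  have R0: "R0 = x\<^sup>2 - 1" if "R1 = x\<^sup>2 - 1" "R2 = x\<^sup>2 - 1" "R3 = x\<^sup>2 - 1"
    using trace that by Groebner_Basis.algebra
  have "R1 = x\<^sup>2 - 1 \<and> R3 = x\<^sup>2 - 1 \<longleftrightarrow> S = x\<^sup>2 - 1 \<and> T = 0"
    unfolding R1 R3 by (intro iffI conjI; elim conjE) Groebner_Basis.algebra+
  then show ?thesis unfolding S_def[symmetric] T[symmetric] using R0 by blast
qed

text \<open>Multiplying by the nonzero \<open>4 * a * b * c\<close> pairs every inverse with its
  partner and leaves polynomials in \<open>a\<close>, \<open>b\<close>, \<open>c\<close> and
  \<open>x\<close>.\<close>

lemma equations_cleared:
  fixes x a b c a' b' c' :: complex
  assumes inv: "a * a' = 1" "b * b' = 1" "c * c' = 1"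
  shows "(1 + (1 - x/2) * a - x/2 * b + (x - 2) * c) * (1 + (1 - x/2) * a' - x/2 * b' + (x - 2) * c') = x\<^sup>2 - 1
    \<longleftrightarrow> (2 - (x - 2) * a - x * b + 2 * (x - 2) * c)
        * (2 * a * b * c - (x - 2) * b * c - x * a * c + 2 * (x - 2) * a * b) = 4 * (x\<^sup>2 - 1) * a * b * c" (is "?l1 = _ \<longleftrightarrow> ?r1 = _")
  and "(1 - c) * (1 - c') + x\<^sup>2/4 * (a - b) * (a' - b') = x\<^sup>2 - 1
    \<longleftrightarrow> - 4 * (1 - c)\<^sup>2 * a * b - x\<^sup>2 * (a - b)\<^sup>2 * c = 4 * (x\<^sup>2 - 1) * a * b * c" (is "?l2 = _ \<longleftrightarrow> ?r2 = _")
proof -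
  have nz: "4 * a * b * c \<noteq> 0" using inv by auto
  have "4 * a * b * c * ?l1 = (2 - (x - 2) * a - x * b + 2 * (x - 2) * c) *
      (2 * a * b * c * 1 - (x - 2) * b * c * (a * a') - x * a * c * (b * b') + 2 * (x - 2) * a * b * (c * c'))"
    by (simp add: field_simps power2_eq_square)
  then have 1: "4 * a * b * c * ?l1 = ?r1" unfolding inv by simp
  show "?l1 = x\<^sup>2 - 1 \<longleftrightarrow> ?r1 = 4 * (x\<^sup>2 - 1) * a * b * c"
    using mult_left_cancel[OF nz, of ?l1 "x\<^sup>2 - 1"] unfolding 1 by (simp only: mult_ac)
  have "4 * a * b * c * ?l2 = 4 * (1 - c) * a * b * (c - c * c') + x\<^sup>2 * (a - b) * c * (b * (a * a') - a * (b * b'))"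
    by (simp add: field_simps power2_eq_square)
  then have 2: "4 * a * b * c * ?l2 = ?r2" unfolding inv by (simp add: algebra_simps power2_eq_square)
  show "?l2 = x\<^sup>2 - 1 \<longleftrightarrow> ?r2 = 4 * (x\<^sup>2 - 1) * a * b * c"
    using mult_left_cancel[OF nz, of ?l2 "x\<^sup>2 - 1"] unfolding 2 by (simp only: mult_ac)
qed

section \<open>The three components of the solution set\<close>

text \<open>The second equation becomes a quadratic in \<open>c\<close> alone; modulo it, the first
  one splits into \<open>a - c\<close>, giving (i), and a factor linear in \<open>a\<close>, giving
  (ii).\<close>

lemma solutions_w1_eq_w2:
  fixes x a c :: complex
  assumes nz: "a \<noteq> 0" "c \<noteq> 0" "x - 1 \<noteq> 0" "x\<^sup>2 - 2 * x - 1 \<noteq> 0"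
  shows "(2 - (x - 2) * a - x * a + 2 * (x - 2) * c)
        * (2 * a * a * c - (x - 2) * a * c - x * a * c + 2 * (x - 2) * a * a) = 4 * (x\<^sup>2 - 1) * a * a * c
    \<and> - 4 * (1 - c)\<^sup>2 * a * a - x\<^sup>2 * (a - a)\<^sup>2 * c = 4 * (x\<^sup>2 - 1) * a * a * c
   \<longleftrightarrow> c + 1 / c + x\<^sup>2 - 3 = 0 \<and> (a = c \<or> a = (- (x - 3) * c + (x - 1)) / (x\<^sup>2 - 2 * x - 1))"
  (is "?R \<and> ?S \<longleftrightarrow> ?C \<and> _")
proof -
  have "?S \<longleftrightarrow> a * a * (c\<^sup>2 + (x\<^sup>2 - 3) * c + 1) = 0"
    by (simp only: diff_self zero_power2 mult_zero_left mult_zero_right diff_zero) (rule iffI; Groebner_Basis.algebra)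
  also have "\<dots> \<longleftrightarrow> c\<^sup>2 + (x\<^sup>2 - 3) * c + 1 = 0" using nz by simp
  finally have S: "?S \<longleftrightarrow> c\<^sup>2 + (x\<^sup>2 - 3) * c + 1 = 0" .
  have C: "?C \<longleftrightarrow> c\<^sup>2 + (x\<^sup>2 - 3) * c + 1 = 0"
    using nz by (simp add: field_simps power2_eq_square)
  have "?R \<longleftrightarrow> a = c \<or> a = (- (x - 3) * c + (x - 1)) / (x\<^sup>2 - 2 * x - 1)"
    if c: "c\<^sup>2 + (x\<^sup>2 - 3) * c + 1 = 0"
  proof -
    \<comment> \<open>This is the leading coefficient, in \<open>a\<close>, of the linear factor.
      Substituting \<open>c = 2 - x\<close> into the quadratic gives the contradiction.\<close>
    have "(c + x - 2) \<noteq> 0"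
    proof
      assume "c + x - 2 = 0"
      then have "(x - 1) * (x\<^sup>2 - 2 * x - 1) = 0" using c by Groebner_Basis.algebra
      then show False using nz by simp
    qed
    moreover have "?R \<longleftrightarrow> a * (x - 1) * ((a - c) * ((c + x - 2) * a - (1 + (x - 2) * c))) = 0"
      using c by (intro iffI) Groebner_Basis.algebra+
    \<comment> \<open>The quadratic for \<open>c\<close> trades the denominator
      \<open>c + x - 2\<close> for the constant one appearing in (ii).\<close>
    moreover have "(x\<^sup>2 - 2 * x - 1) * ((c + x - 2) * a - (1 + (x - 2) * c))
        = (c + x - 2) * ((x\<^sup>2 - 2 * x - 1) * a - (- (x - 3) * c + (x - 1)))"
      using c by Groebner_Basis.algebra
    ultimately have "?R \<longleftrightarrow> a = c \<or> (x\<^sup>2 - 2 * x - 1) * a - (- (x - 3) * c + (x - 1)) = 0"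
      using nz by (metis mult_eq_0_iff eq_iff_diff_eq_0)
    then show ?thesis using nz by (simp add: eq_divide_eq mult.commute)
  qed
  then show ?thesis unfolding S C by blast
qed

text \<open>At \<open>c = 1\<close> the second equation is
  \<open>x\<^sup>2 * (a + b)\<^sup>2 = 4 * a * b\<close>, and modulo it the first reduces to
  \<open>?G = 0\<close>. Combining the two produces the factor \<open>a - 1\<close>, which separates
  (iv) from (v).\<close>

lemma solutions_w3_eq_1:
  fixes x a b :: complex
  assumes nz: "a \<noteq> 0" "b \<noteq> 0" "x \<noteq> 0" "x - 1 \<noteq> 0" "x + 1 \<noteq> 0"
  shows "(2 - (x - 2) * a - x * b + 2 * (x - 2) * 1)
        * (2 * a * b * 1 - (x - 2) * b * 1 - x * a * 1 + 2 * (x - 2) * a * b) = 4 * (x\<^sup>2 - 1) * a * b * 1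
    \<and> - 4 * (1 - 1)\<^sup>2 * a * b - x\<^sup>2 * (a - b)\<^sup>2 * 1 = 4 * (x\<^sup>2 - 1) * a * b * 1
   \<longleftrightarrow> a = 1 \<and> b + 1 / b = - 2 * (x\<^sup>2 - 2) / x\<^sup>2 \<or> a + 1 / a = - 2 / x \<and> b = 1 / a"
  (is "?R \<and> ?S \<longleftrightarrow> ?iv \<or> ?v")
proof -
  have S: "?S \<longleftrightarrow> x\<^sup>2 * (a + b)\<^sup>2 = 4 * a * b"
    by (simp only: diff_self zero_power2 mult_zero_left mult_zero_right diff_0) (rule iffI; Groebner_Basis.algebra)
  let ?G = "x * (x - 2) * (a\<^sup>2 + 1) * b + x\<^sup>2 * (b\<^sup>2 + 1) * a + 4 * (x - 1) * a * b"
  have R: "?R \<longleftrightarrow> ?G = 0" if s: "x\<^sup>2 * (a + b)\<^sup>2 = 4 * a * b"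
  proof -
    have "?R \<longleftrightarrow> x * ((2 - (x - 2) * a - x * b + 2 * (x - 2))
        * (2 * a * b - (x - 2) * b - x * a + 2 * (x - 2) * a * b) - 4 * (x\<^sup>2 - 1) * a * b) = 0"
      using nz by simp
    also have "x * ((2 - (x - 2) * a - x * b + 2 * (x - 2))
        * (2 * a * b - (x - 2) * b - x * a + 2 * (x - 2) * a * b) - 4 * (x\<^sup>2 - 1) * a * b)
        = - 2 * (x - 1) * ?G"
      using s by Groebner_Basis.algebra
    finally show ?thesis using nz by simp
  qed
  have iv: "?iv \<longleftrightarrow> a = 1 \<and> x\<^sup>2 * (b\<^sup>2 + 1) = - 2 * (x\<^sup>2 - 2) * b"
    using nz by (auto simp: field_simps power2_eq_square)
  have "?v \<longleftrightarrow> x * (a + 1 / a) = - 2 \<and> b = 1 / a"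
    using nz by (metis nonzero_eq_divide_eq mult.commute)
  also have "\<dots> \<longleftrightarrow> x * (a + b) = - 2 \<and> b = 1 / a" by auto
  also have "\<dots> \<longleftrightarrow> x * (a + b) = - 2 \<and> a * b = 1"
    using nz by (metis nonzero_eq_divide_eq mult.commute)
  finally have v: "?v \<longleftrightarrow> x * (a + b) = - 2 \<and> a * b = 1" .
  have "x\<^sup>2 * (a + b)\<^sup>2 = 4 * a * b \<and> ?G = 0 \<longleftrightarrow>
    (a = 1 \<and> x\<^sup>2 * (b\<^sup>2 + 1) = - 2 * (x\<^sup>2 - 2) * b) \<or> (x * (a + b) = - 2 \<and> a * b = 1)"
  proof (intro iffI; (elim disjE conjE)?)
    assume s: "x\<^sup>2 * (a + b)\<^sup>2 = 4 * a * b" and G: "?G = 0"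
    have "2 * b * ((a - 1) * (2 * a * (b - 1) - x * (a + b) * (a - 1))) = 0"
      using s G by Groebner_Basis.algebra
    then consider "a = 1" | "2 * a * (b - 1) = x * (a + b) * (a - 1)" using nz by auto
    then show "(a = 1 \<and> x\<^sup>2 * (b\<^sup>2 + 1) = - 2 * (x\<^sup>2 - 2) * b) \<or> (x * (a + b) = - 2 \<and> a * b = 1)"
    proof cases
      case 1
      then show ?thesis using s by Groebner_Basis.algebra
    next
      case 2
      \<comment> \<open>Squaring makes \<open>x\<^sup>2 * (a + b)\<^sup>2\<close> appear, which
        \<open>s\<close> replaces by \<open>4 * a * b\<close>; the result factors.\<close>
      have "(2 * a * (b - 1))\<^sup>2 = (x * (a + b) * (a - 1))\<^sup>2" unfolding 2 ..
      then have "4 * a * ((a * b - 1) * (b - a)) = 0" using s by Groebner_Basis.algebra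
      then have "a * b = 1 \<or> b = a" using nz by auto
      moreover have "b \<noteq> a"
      proof
        assume "b = a"
        then have "4 * a\<^sup>2 * ((x - 1) * (x + 1)) = 0"
          using s by (simp add: algebra_simps power2_eq_square)
        then show False using nz by simp
      qed
      ultimately have ab: "a * b = 1" by blast
      have "2 * (x - 1) * (x * (a + b) + 2) = 0" using G ab by Groebner_Basis.algebra
      then have "x * (a + b) + 2 = 0" using nz by simp
      then show ?thesis using ab by (simp add: eq_neg_iff_add_eq_0)
    qed
  qed Groebner_Basis.algebra+
  then show ?thesis unfolding iv v S using R by blast
qed

text \<open>Dividing the second equation by \<open>a * b\<close> gives \<open>?E\<close>, and modulo
  \<open>?E\<close> the first is equivalent to the vanishing of
  \<open>a * b * (x - 1) * (b + 1) * ?L\<close>. At \<open>b = -1\<close>, \<open>?E\<close> is the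
  equation of (iii).\<close>

lemma solutions_w3_eq_neg_w1_w2:
  fixes x a b :: complex
  assumes nz: "a \<noteq> 0" "b \<noteq> 0" "x - 1 \<noteq> 0" "x\<^sup>2 - 4 \<noteq> 0"
  defines "c \<equiv> - (a * b)"
  shows "(2 - (x - 2) * a - x * b + 2 * (x - 2) * c)
        * (2 * a * b * c - (x - 2) * b * c - x * a * c + 2 * (x - 2) * a * b) = 4 * (x\<^sup>2 - 1) * a * b * c
    \<and> - 4 * (1 - c)\<^sup>2 * a * b - x\<^sup>2 * (a - b)\<^sup>2 * c = 4 * (x\<^sup>2 - 1) * a * b * c
   \<longleftrightarrow> a + 1 / a = 2 * (x\<^sup>2 - 6) / (x\<^sup>2 - 4) \<and> b = -1
     \<or> 4 * (1 + a * b)\<^sup>2 - x\<^sup>2 * (a - b)\<^sup>2 = 4 * (x\<^sup>2 - 1) * a * b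
       \<and> (- 2 * a\<^sup>2 + (x - 4) * a + x) * b + (x * a\<^sup>2 + (x - 4) * a - 2) = 0"
  (is "?R \<and> ?S \<longleftrightarrow> ?iii \<and> _ \<or> ?E \<and> ?L = 0")
proof -
  have "?S \<longleftrightarrow> a * b * (4 * (1 + a * b)\<^sup>2 - x\<^sup>2 * (a - b)\<^sup>2 - 4 * (x\<^sup>2 - 1) * a * b) = 0"
    unfolding c_def by (rule iffI; Groebner_Basis.algebra)
  then have S: "?S \<longleftrightarrow> ?E" using nz by simp
  have "?R \<longleftrightarrow> a * b * (x - 1) * ((b + 1) * ?L) = 0" if ?E
    using that unfolding c_def by (intro iffI) Groebner_Basis.algebra+
  then have R: "?R \<longleftrightarrow> b = -1 \<or> ?L = 0" if ?E
    using nz that by (simp add: add_eq_0_iff2)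
  have "?iii \<longleftrightarrow> (x\<^sup>2 - 4) * (a\<^sup>2 + 1) = 2 * (x\<^sup>2 - 6) * a"
    using nz by (simp add: field_simps power2_eq_square)
  also have "\<dots> \<longleftrightarrow> ?E" if "b = -1" unfolding that by (rule iffI; Groebner_Basis.algebra)
  finally have "b = -1 \<Longrightarrow> ?iii \<longleftrightarrow> ?E" .
  then show ?thesis using S R by blast
qed

section \<open>The residual solutions and case (vi)\<close>

text \<open>This guarantees that the equation linear in \<open>b\<close> determines
  \<open>b\<close>: its two coefficients have no common root. They are reversals of each other, so
  combining them to remove the leading or the constant term leaves two linear equations.\<close>

lemma residual_linear_factor_nonzero:
  fixes x a :: complex
  assumes "a \<noteq> 0" "x + 2 \<noteq> 0" "x - 3 \<noteq> 0"
    and M: "- 2 * a\<^sup>2 + (x - 4) * a + x = 0" and N: "x * a\<^sup>2 + (x - 4) * a - 2 = 0"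
  shows False
proof -
  have "(x + 2) * ((x - 4) * a + (x - 2)) = 0" using M N by Groebner_Basis.algebra
  then have 1: "(x - 4) * a + (x - 2) = 0" using assms by simp
  have "(x + 2) * (a * ((x - 2) * a + (x - 4))) = 0" using M N by Groebner_Basis.algebra
  then have 2: "(x - 2) * a + (x - 4) = 0" using assms by simp
  have "(x - 3) * (a + 1) = 0" using 1 2 by Groebner_Basis.algebra
  then have "a = -1" using assms by (simp add: add_eq_0_iff2)
  then show False using 1 by simp
qed

text \<open>The resultant of the two equations left on \<open>w\<^sub>3 = - w\<^sub>1 w\<^sub>2\<close> with respect to \<open>w\<^sub>2\<close> is
  \<open>8a\<close> times this quartic.\<close>

definition residual_quartic :: "complex \<Rightarrow> complex \<Rightarrow> complex" where
  "residual_quartic x a = - (x * (x + 1) * (a^4 + 1)) - (x - 1) * (x - 2) * (a^3 + a)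
     + (2 * x\<^sup>2 + 8 * x - 14) * a\<^sup>2"

text \<open>The factor in front is the square of the coefficient of \<open>b\<close>, so the
  hypothesis eliminates \<open>b\<close> without division.\<close>

lemma residual_elimination:
  fixes x a b :: complex
  assumes "(- 2 * a\<^sup>2 + (x - 4) * a + x) * b + (x * a\<^sup>2 + (x - 4) * a - 2) = 0"
  shows "(- 2 * a\<^sup>2 + (x - 4) * a + x)\<^sup>2 * (4 * (1 + a * b)\<^sup>2 - x\<^sup>2 * (a - b)\<^sup>2 - 4 * (x\<^sup>2 - 1) * a * b)
    = 8 * a * residual_quartic x a"
  using assms unfolding residual_quartic_def by Groebner_Basis.algebra

text \<open>For \<open>a \<noteq> 0\<close>, dividing by \<open>- a\<^sup>2\<close> and setting
  \<open>u = a + 1 / a\<close> turns the quartic into \<open>x * (x + 1) * u\<^sup>2 + (x - 1) * (x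
  - 2) * u - 2 * (2 * x + 7) * (x - 1)\<close>, whose discriminant is
  \<open>((x + 2) * r)\<^sup>2\<close>. Each factor belongs to one root \<open>u\<close>.\<close>

lemma residual_quartic_factor:
  fixes x a r :: complex
  assumes "r\<^sup>2 = (17 * x - 1) * (x - 1)"
  shows "- 4 * x * (x + 1) * residual_quartic x a
    = (2 * x * (x + 1) * (a\<^sup>2 + 1) - (- (x - 1) * (x - 2) + (x + 2) * r) * a)
      * (2 * x * (x + 1) * (a\<^sup>2 + 1) - (- (x - 1) * (x - 2) + (x + 2) * (- r)) * a)"
  using assms unfolding residual_quartic_def by Groebner_Basis.algebra

text \<open>The numerator \<open>a\<^sup>2 - 1\<close> in (vi) must not vanish. The values of the
  quartic at 1 and -1 are \<open>- 2 * (x - 3)\<^sup>2\<close> and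
  \<open>2 * (x\<^sup>2 - 5)\<close>.\<close>

lemma residual_quartic_root_sq_ne_1:
  fixes x a :: complex
  assumes "residual_quartic x a = 0" "x - 3 \<noteq> 0" "x\<^sup>2 - 5 \<noteq> 0"
  shows "a\<^sup>2 \<noteq> 1"
proof
  assume "a\<^sup>2 = 1"
  then consider "a = 1" | "a = -1" by (auto simp: power2_eq_1_iff)
  then show False
  proof cases
    case 1
    have "- 2 * (x - 3)\<^sup>2 = 0" using assms(1) unfolding residual_quartic_def 1
      by (simp add: algebra_simps power2_eq_square)
    then show False using assms by simp
  next
    case 2
    have "2 * (x\<^sup>2 - 5) = 0" using assms(1) unfolding residual_quartic_def 2
      by (simp add: algebra_simps power2_eq_square)
    then show False using assms(3) by simp
  qed
qed

text \<open>Let \<open>a\<^sup>2 = a01 * a - 1\<close>. The first identity gives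
  \<open>a12 * a - a02 = a * (a02 * a + a03)\<close>, the source of \<open>w1 * w2 = - w3\<close>.
  The others show that the (vi) formula for \<open>b\<close> solves the linear equation: after
  clearing its denominator and reducing, the second is the constant coefficient and the third, given
  the other two, is minus the coefficient of \<open>a\<close>.\<close>

lemma case_vi_coefficient_identities:
  fixes x r :: complex
  assumes nz: "x \<noteq> 0" "x + 1 \<noteq> 0" "x - 3 \<noteq> 0" and r: "r\<^sup>2 = (17 * x - 1) * (x - 1)"
  defines "a01 \<equiv> (- (x - 1) * (x - 2) + (x + 2) * r) / (2 * x * (x + 1))"
    and "a02 \<equiv> ((x + 2) * (x - 1) - (x - 2) * r) / (2 * x * (x - 3))"
    and "a03 \<equiv> (5 * x^2 - 2 * x - 19 - (x - 1) * r) / (2 * (x + 1) * (x - 3))"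
    and "a12 \<equiv> 2 * (- (x^4) + 2 * x^3 + 4 * x^2 - 10 * x + 1 + (x - 1) * r) / (x^2 * (x + 1) * (x - 3))"
  shows "a12 = a02 * a01 + a03"
    and "(x + 2) * a02 - a12 * (x * a01 + x - 4) - 2 * (x + 2) - a01 * (x - 4 - 2 * a01) = 0"
    and "a02 * (x * a01 + x - 4) + (x + 2) * a03 + (x - 2) * a01 + 2 * (x - 4) = 0"
proof -
  define n01 where "n01 = - (x - 1) * (x - 2) + (x + 2) * r"
  define n02 where "n02 = (x + 2) * (x - 1) - (x - 2) * r"
  define n03 where "n03 = 5 * x^2 - 2 * x - 19 - (x - 1) * r"
  define n12 where "n12 = - (x^4) + 2 * x^3 + 4 * x^2 - 10 * x + 1 + (x - 1) * r"
  note n_defs = n01_def n02_def n03_def n12_def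
  \<comment> \<open>With denominators cleared, each identity becomes a polynomial one in
    \<open>x\<close> and \<open>r\<close>, settled by the equation for
    \<open>r\<^sup>2\<close>.\<close>
  have e01: "2 * x * (x + 1) * a01 = n01" and e02: "2 * x * (x - 3) * a02 = n02"
    and e03: "2 * (x + 1) * (x - 3) * a03 = n03" and e12: "x^2 * (x + 1) * (x - 3) * a12 = 2 * n12"
    using nz unfolding a01_def a02_def a03_def a12_def n_defs
    by (simp_all del: distrib_left_numeral right_diff_distrib_numeral)
  have "4 * x\<^sup>2 * (x + 1) * (x - 3) * (a12 - (a02 * a01 + a03)) = 4 * (x^2 * (x + 1) * (x - 3) * a12)
      - (2 * x * (x - 3) * a02) * (2 * x * (x + 1) * a01) - 2 * x\<^sup>2 * (2 * (x + 1) * (x - 3) * a03)"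
    by Groebner_Basis.algebra
  also have "\<dots> = 8 * n12 - n02 * n01 - 2 * x\<^sup>2 * n03" unfolding e01 e02 e03 e12 by simp
  also have "\<dots> = 0" using r unfolding n_defs by Groebner_Basis.algebra
  finally show T1: "a12 = a02 * a01 + a03" using nz by simp
  have "2 * x\<^sup>2 * (x + 1)\<^sup>2 * (x - 3)
      * ((x + 2) * a02 - a12 * (x * a01 + x - 4) - 2 * (x + 2) - a01 * (x - 4 - 2 * a01))
    = (x + 2) * x * (x + 1)\<^sup>2 * (2 * x * (x - 3) * a02)
      - (x^2 * (x + 1) * (x - 3) * a12) * (2 * x * (x + 1) * a01 + 2 * (x + 1) * (x - 4))
      - 4 * x\<^sup>2 * (x + 1)\<^sup>2 * (x - 3) * (x + 2)
      - (x - 3) * (2 * x * (x + 1) * a01) * (x * (x + 1) * (x - 4) - 2 * x * (x + 1) * a01)"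
    by Groebner_Basis.algebra
  also have "\<dots> = 0" unfolding e01 e02 e12 using r unfolding n_defs by Groebner_Basis.algebra
  finally show "(x + 2) * a02 - a12 * (x * a01 + x - 4) - 2 * (x + 2) - a01 * (x - 4 - 2 * a01) = 0"
    using nz by simp
  have "4 * x * (x + 1) * (x - 3)
      * (a02 * (x * a01 + x - 4) + (x + 2) * a03 + (x - 2) * a01 + 2 * (x - 4))
    = (2 * x * (x - 3) * a02) * (2 * x * (x + 1) * a01 + 2 * (x + 1) * (x - 4))
      + 2 * x * (x + 2) * (2 * (x + 1) * (x - 3) * a03)
      + 2 * (x - 3) * (x - 2) * (2 * x * (x + 1) * a01) + 8 * x * (x + 1) * (x - 3) * (x - 4)"
    by Groebner_Basis.algebra
  also have "\<dots> = 0" unfolding e01 e02 e03 using r unfolding n_defs by Groebner_Basis.algebra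
  finally show "a02 * (x * a01 + x - 4) + (x + 2) * a03 + (x - 2) * a01 + 2 * (x - 4) = 0"
    using nz by simp
qed

text \<open>Once \<open>r\<close>, and with it \<open>a + 1 / a\<close>, is fixed, \<open>b\<close>
  is determined by its linear equation and \<open>c\<close> by \<open>c = - (a * b)\<close>.
  Conversely, the quartic vanishes at \<open>a\<close>, so \<open>residual_elimination\<close>
  recovers \<open>?E\<close>.\<close>

lemma residual_solutions_fixed_root:
  fixes x r a b c :: complex
  assumes nz: "a \<noteq> 0" "b \<noteq> 0" "c \<noteq> 0" "x \<noteq> 0" "x + 1 \<noteq> 0" "x + 2 \<noteq> 0" "x - 3 \<noteq> 0" "x\<^sup>2 - 5 \<noteq> 0"
    and r: "r\<^sup>2 = (17 * x - 1) * (x - 1)"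
  defines "a01 \<equiv> (- (x - 1) * (x - 2) + (x + 2) * r) / (2 * x * (x + 1))"
    and "a02 \<equiv> ((x + 2) * (x - 1) - (x - 2) * r) / (2 * x * (x - 3))"
    and "a03 \<equiv> (5 * x^2 - 2 * x - 19 - (x - 1) * r) / (2 * (x + 1) * (x - 3))"
    and "a12 \<equiv> 2 * (- (x^4) + 2 * x^3 + 4 * x^2 - 10 * x + 1 + (x - 1) * r) / (x^2 * (x + 1) * (x - 3))"
  assumes a: "a + 1 / a = a01"
  shows "c = - (a * b) \<and> 4 * (1 + a * b)\<^sup>2 - x\<^sup>2 * (a - b)\<^sup>2 = 4 * (x\<^sup>2 - 1) * a * b
      \<and> (- 2 * a\<^sup>2 + (x - 4) * a + x) * b + (x * a\<^sup>2 + (x - 4) * a - 2) = 0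
    \<longleftrightarrow> b = (a\<^sup>2 - 1) / (a12 * a - a02) \<and> c = (a\<^sup>2 - 1) / (- a02 * a - a03)"
    (is "_ \<and> ?E \<and> _ \<longleftrightarrow> _")
proof -
  let ?M = "- 2 * a\<^sup>2 + (x - 4) * a + x" and ?N = "x * a\<^sup>2 + (x - 4) * a - 2"
  note ids = case_vi_coefficient_identities[OF nz(4,5,7) r, folded a01_def a02_def a03_def a12_def]
  have a2: "a\<^sup>2 = a01 * a - 1" using a nz by (simp add: field_simps power2_eq_square)
  have "2 * x * (x + 1) * (a\<^sup>2 + 1) = (- (x - 1) * (x - 2) + (x + 2) * r) * a"
    using nz unfolding a2 a01_def by simp
  then have K: "residual_quartic x a = 0"
    using residual_quartic_factor[OF r, of a] nz by simp
  have d: "a12 * a - a02 = a * (a02 * a + a03)"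
    using ids(1) a2 by Groebner_Basis.algebra
  have Z: "?M * (a\<^sup>2 - 1) + ?N * (a12 * a - a02) = 0"
    using ids a2 by Groebner_Basis.algebra
  show ?thesis
  proof (intro iffI; elim conjE)
    assume c: "c = - (a * b)" and L: "?M * b + ?N = 0"
    have "?M \<noteq> 0" using residual_linear_factor_nonzero[of a x] nz L by auto
    moreover have "?M * (b * (a12 * a - a02) - (a\<^sup>2 - 1)) = 0" using Z L by Groebner_Basis.algebra
    ultimately have b: "b * (a12 * a - a02) = a\<^sup>2 - 1" by simp
    have c': "c * (- a02 * a - a03) = a\<^sup>2 - 1" using b c d by Groebner_Basis.algebra
    \<comment> \<open>A nonzero numerator forces both denominators to be nonzero, so the quotients
      are genuine.\<close>
    have "a\<^sup>2 - 1 \<noteq> 0" using residual_quartic_root_sq_ne_1[OF K] nz by simp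
    then have "a12 * a - a02 \<noteq> 0" "- a02 * a - a03 \<noteq> 0"
      using b c' by (metis mult_zero_right)+
    then show "b = (a\<^sup>2 - 1) / (a12 * a - a02) \<and> c = (a\<^sup>2 - 1) / (- a02 * a - a03)"
      using b c' by (simp add: eq_divide_eq)
  next
    assume b: "b = (a\<^sup>2 - 1) / (a12 * a - a02)" and c: "c = (a\<^sup>2 - 1) / (- a02 * a - a03)"
    \<comment> \<open>Division by zero yields 0, so a vanishing denominator would contradict
      \<open>b \<noteq> 0\<close> or \<open>c \<noteq> 0\<close>.\<close>
    have d1: "a12 * a - a02 \<noteq> 0" and d2: "- a02 * a - a03 \<noteq> 0"
      using b c nz by (metis div_by_0)+
    have b': "b * (a12 * a - a02) = a\<^sup>2 - 1" using b d1 by simp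
    have c': "c * (- a02 * a - a03) = a\<^sup>2 - 1" using c d2 by simp
    have "(c + a * b) * (- a02 * a - a03) = 0" using b' c' d by Groebner_Basis.algebra
    then have "c = - (a * b)" using d2 by (simp add: eq_neg_iff_add_eq_0)
    moreover have "(?M * b + ?N) * (a12 * a - a02) = 0" using Z b' by Groebner_Basis.algebra
    then have L: "?M * b + ?N = 0" using d1 by simp
    moreover have "?M \<noteq> 0" using residual_linear_factor_nonzero[of a x] nz L by auto
    then have ?E using residual_elimination[OF L] K by simp
    ultimately show "c = - (a * b) \<and> ?E \<and> ?M * b + ?N = 0" by blast
  qed
qed


section \<open>Assembly of the classification\<close>

theorem theorem4p1:
  fixes q :: nat and A :: "nat \<Rightarrow> complex mat" and w1 w2 w3 :: complex
  assumes hq: "q \<ge> 4"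
    and hscheme: "sym_assoc_scheme (q^2 - 1) 3 A"
    and hP: "first_eigenmatrix (q^2 - 1) 3 A (P_thm q)"
    and hw: "w1 \<noteq> 0" "w2 \<noteq> 0" "w3 \<noteq> 0"
  defines "W \<equiv> A 0 + w1 \<cdot>\<^sub>m A 1 + w2 \<cdot>\<^sub>m A 2 + w3 \<cdot>\<^sub>m A 3"
    and "case_vi \<equiv> (\<exists>r::real. r^2 = (17 * real q - 1) * (real q - 1) \<and>
           (let x = (of_nat q :: complex);
                a01 = (- (x - 1) * (x - 2) + (x + 2) * of_real r) / (2 * x * (x + 1));
                a02 = ((x + 2) * (x - 1) - (x - 2) * of_real r) / (2 * x * (x - 3));
                a03 = (5 * x^2 - 2 * x - 19 - (x - 1) * of_real r) / (2 * (x + 1) * (x - 3));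
                a12 = 2 * (- (x^4) + 2 * x^3 + 4 * x^2 - 10 * x + 1 + (x - 1) * of_real r)
                        / (x^2 * (x + 1) * (x - 3));
                a13 = - a02
            in w1 + 1 / w1 = a01 \<and>
               w2 = (w1^2 - 1) / (a12 * w1 - a02) \<and>
               w3 = (w1^2 - 1) / (a13 * w1 - a03)))"
  shows "(type_II (q^2 - 1) W \<longleftrightarrow>
          (let x = (of_nat q :: complex) in
            (w1 = w2 \<and> w2 = w3 \<and> w3 + 1 / w3 + x^2 - 3 = 0)
          \<or> (w3 + 1 / w3 + x^2 - 3 = 0 \<and> w1 = w2 \<and>
              w2 = (- (x - 3) * w3 + (x - 1)) / (x^2 - 2 * x - 1))
          \<or> (w1 + 1 / w1 = 2 * (x^2 - 6) / (x^2 - 4) \<and> w2 = -1 \<and> w3 = w1)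
          \<or> (w1 = 1 \<and> w3 = 1 \<and> w2 + 1 / w2 = - 2 * (x^2 - 2) / x^2)
          \<or> (w1 + 1 / w1 = - 2 / x \<and> w2 = 1 / w1 \<and> w3 = 1)
          \<or> case_vi))
        \<and> (case_vi \<longrightarrow> w1 * w2 = - w3)"
proof -
  define x :: complex where "x = of_nat q"
  define y :: real where "y = real q"
  have y: "y \<ge> 4" and xy: "x = of_real y" using hq by (auto simp: x_def y_def)
  have nz_real: "of_real t \<noteq> (0 :: complex)" if "t > 0" for t :: real using that by simp
  \<comment> \<open>These bounds make the quadratic expressions in \<open>nz\<close> positive reals;
    embedding the reals then gives nonvanishing over the complex numbers.\<close>
  have y2: "y\<^sup>2 \<ge> 4 * y" "y\<^sup>2 \<ge> 16"
    using y mult_right_mono[of 4 y y] mult_mono[of 4 y 4 y] by (auto simp: power2_eq_square)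
  have nz: "x \<noteq> 0" "x - 1 \<noteq> 0" "x + 1 \<noteq> 0" "x + 2 \<noteq> 0" "x - 3 \<noteq> 0"
    "x\<^sup>2 - 2 * x - 1 \<noteq> 0" "x\<^sup>2 - 4 \<noteq> 0" "x\<^sup>2 - 5 \<noteq> 0"
    using nz_real[of y] nz_real[of "y - 1"] nz_real[of "y + 1"] nz_real[of "y + 2"] nz_real[of "y - 3"]
      nz_real[of "y\<^sup>2 - 2 * y - 1"] nz_real[of "y\<^sup>2 - 4"] nz_real[of "y\<^sup>2 - 5"] y y2
    unfolding xy by simp_all
  let ?n = "q\<^sup>2 - 1"
  have n: "of_nat ?n = x\<^sup>2 - 1"
    using hq by (simp add: x_def of_nat_diff)
  define w where "w = (\<lambda>i. [1, w1, w2, w3] ! i)"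
  have w: "w 0 = 1" "w 1 = w1" "w 2 = w2" "w 3 = w3"
    by (simp_all add: w_def)
  have le3: "(\<forall>i\<le>3. Q i) \<longleftrightarrow> Q 0 \<and> Q 1 \<and> Q 2 \<and> Q (3::nat)" for Q
    by (auto simp: le_Suc_eq numeral_eq_Suc)
  have sum3: "(\<Sum>i\<le>3. f i) = f 0 + f 1 + f 2 + f (3::nat)" for f :: "nat \<Rightarrow> complex"
    by (simp add: numeral_eq_Suc)
  have A: "A 0 \<in> carrier_mat ?n ?n" "A 1 \<in> carrier_mat ?n ?n" "A 2 \<in> carrier_mat ?n ?n" "A 3 \<in> carrier_mat ?n ?n"
    using hscheme unfolding sym_assoc_scheme_def by simp_all
  have inv: "w1 * inverse w1 = 1" "w2 * inverse w2 = 1" "w3 * inverse w3 = 1" using hw by simp_all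
  define eqs where "eqs a b c \<longleftrightarrow> (2 - (x - 2) * a - x * b + 2 * (x - 2) * c)
        * (2 * a * b * c - (x - 2) * b * c - x * a * c + 2 * (x - 2) * a * b) = 4 * (x\<^sup>2 - 1) * a * b * c
    \<and> - 4 * (1 - c)\<^sup>2 * a * b - x\<^sup>2 * (a - b)\<^sup>2 * c = 4 * (x\<^sup>2 - 1) * a * b * c" for a b c
  have "W = lin_comb ?n 3 w A"
    unfolding W_def by (rule eq_matI) (use A in \<open>auto simp: sum3 w w(2)[simplified]\<close>)
  moreover have "w i \<noteq> 0" if "i \<le> 3" for i
    using le3[of "\<lambda>i. w i \<noteq> 0"] that hw w by simp
  ultimately have "type_II ?n W \<longleftrightarrow>
    (\<forall>i\<le>3. (\<Sum>j\<le>3. w j * P_thm q i j) * (\<Sum>j\<le>3. inverse (w j) * P_thm q i j) = x\<^sup>2 - 1)"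
    using type_II_lin_comb_iff[OF hscheme hP, of w] n by simp
  also have "\<dots> \<longleftrightarrow>
      (1 + (x\<^sup>2/2 - x) * w1 + x\<^sup>2/2 * w2 + (x - 2) * w3)
        * (1 + (x\<^sup>2/2 - x) * inverse w1 + x\<^sup>2/2 * inverse w2 + (x - 2) * inverse w3) = x\<^sup>2 - 1
    \<and> (1 + x/2 * w1 - x/2 * w2 - w3) * (1 + x/2 * inverse w1 - x/2 * inverse w2 - inverse w3) = x\<^sup>2 - 1
    \<and> (1 + (1 - x/2) * w1 - x/2 * w2 + (x - 2) * w3)
        * (1 + (1 - x/2) * inverse w1 - x/2 * inverse w2 + (x - 2) * inverse w3) = x\<^sup>2 - 1
    \<and> (1 - x/2 * w1 + x/2 * w2 - w3) * (1 - x/2 * inverse w1 + x/2 * inverse w2 - inverse w3) = x\<^sup>2 - 1"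
    unfolding le3 sum3 w P_thm_def x_def[symmetric] Let_def by (simp add: mult.commute)
  also note eigenvalue_equations_iff[OF nz(1) inv]
  finally have main: "type_II ?n W \<longleftrightarrow> eqs w1 w2 w3 \<and> (w1 = w2 \<or> w3 = 1 \<or> w3 = - (w1 * w2))"
    unfolding eqs_def equations_cleared[OF inv] by blast
  have c1: "eqs w1 w1 w3 \<longleftrightarrow> w3 + 1 / w3 + x\<^sup>2 - 3 = 0 \<and>
      (w1 = w3 \<or> w1 = (- (x - 3) * w3 + (x - 1)) / (x\<^sup>2 - 2 * x - 1))"
    unfolding eqs_def by (rule solutions_w1_eq_w2) (use hw nz in auto)
  have c2: "eqs w1 w2 1 \<longleftrightarrow> w1 = 1 \<and> w2 + 1 / w2 = - 2 * (x\<^sup>2 - 2) / x\<^sup>2 \<or> w1 + 1 / w1 = - 2 / x \<and> w2 = 1 / w1"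
    unfolding eqs_def by (rule solutions_w3_eq_1) (use hw nz in auto)
  define resid where "resid \<longleftrightarrow> 4 * (1 + w1 * w2)\<^sup>2 - x\<^sup>2 * (w1 - w2)\<^sup>2 = 4 * (x\<^sup>2 - 1) * w1 * w2
       \<and> (- 2 * w1\<^sup>2 + (x - 4) * w1 + x) * w2 + (x * w1\<^sup>2 + (x - 4) * w1 - 2) = 0"
  have c3: "eqs w1 w2 (- (w1 * w2)) \<longleftrightarrow>
      w1 + 1 / w1 = 2 * (x\<^sup>2 - 6) / (x\<^sup>2 - 4) \<and> w2 = -1 \<or> resid"
    unfolding eqs_def resid_def by (rule solutions_w3_eq_neg_w1_w2) (use hw nz in auto)
  have r_complex: "(complex_of_real r)\<^sup>2 = (17 * x - 1) * (x - 1)" if "r\<^sup>2 = (17 * y - 1) * (y - 1)" for r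
    using arg_cong[OF that, of complex_of_real] unfolding xy by simp
  have c4: "w3 = - (w1 * w2) \<and> resid \<longleftrightarrow> case_vi"
  proof
    assume vi: case_vi
    then obtain r where r: "r\<^sup>2 = (17 * y - 1) * (y - 1)"
      and eqs: "w1 + 1 / w1 = (- (x - 1) * (x - 2) + (x + 2) * of_real r) / (2 * x * (x + 1))"
      and sol: "w2 = (w1\<^sup>2 - 1) / (2 * (- (x^4) + 2 * x^3 + 4 * x^2 - 10 * x + 1 + (x - 1) * of_real r)
                        / (x^2 * (x + 1) * (x - 3)) * w1
              - ((x + 2) * (x - 1) - (x - 2) * of_real r) / (2 * x * (x - 3)))"
        "w3 = (w1\<^sup>2 - 1) / (- (((x + 2) * (x - 1) - (x - 2) * of_real r) / (2 * x * (x - 3))) * w1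
              - (5 * x^2 - 2 * x - 19 - (x - 1) * of_real r) / (2 * (x + 1) * (x - 3)))"
      unfolding case_vi_def Let_def x_def[symmetric] y_def[symmetric] by blast
    show "w3 = - (w1 * w2) \<and> resid"
      unfolding resid_def
      using residual_solutions_fixed_root[OF hw nz(1,3,4,5,8) r_complex[OF r] eqs] sol by blast
  next
    assume "w3 = - (w1 * w2) \<and> resid"
    then have w3: "w3 = - (w1 * w2)" and res: resid by auto
    \<comment> \<open>The radicand is nonnegative as \<open>y \<ge> 4\<close>. The quartic only
      shows that one of two conjugate factors vanishes, so the witness \<open>r\<close> is
      \<open>s\<close> or \<open>- s\<close>.\<close>
    define s where "s = sqrt ((17 * y - 1) * (y - 1))"
    have s: "s\<^sup>2 = (17 * y - 1) * (y - 1)" using y by (simp add: s_def)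
    have "residual_quartic x w1 = 0"
      using residual_elimination[of w1 x w2] res hw unfolding resid_def by simp
    then have "(2 * x * (x + 1) * (w1\<^sup>2 + 1) - (- (x - 1) * (x - 2) + (x + 2) * of_real s) * w1)
        * (2 * x * (x + 1) * (w1\<^sup>2 + 1) - (- (x - 1) * (x - 2) + (x + 2) * of_real (- s)) * w1) = 0"
      using residual_quartic_factor[OF r_complex[OF s], of w1] unfolding of_real_minus by (metis mult_zero_right)
    then obtain r where r: "r = s \<or> r = - s"
      and "2 * x * (x + 1) * (w1\<^sup>2 + 1) - (- (x - 1) * (x - 2) + (x + 2) * of_real r) * w1 = 0"
      unfolding mult_eq_0_iff[of "_ - _"] by blast
    then have "2 * x * (x + 1) * (w1 + 1 / w1) = - (x - 1) * (x - 2) + (x + 2) * of_real r"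
      using hw by (simp add: field_simps power2_eq_square)
    moreover have "2 * x * (x + 1) \<noteq> 0" using nz by simp
    ultimately have eqs: "w1 + 1 / w1 = (- (x - 1) * (x - 2) + (x + 2) * of_real r) / (2 * x * (x + 1))"
      by (metis nonzero_mult_div_cancel_left)
    have r2: "r\<^sup>2 = (17 * y - 1) * (y - 1)" using r s by auto
    show case_vi
      unfolding case_vi_def Let_def x_def[symmetric] y_def[symmetric]
      using residual_solutions_fixed_root[OF hw nz(1,3,4,5,8) r_complex[OF r2] eqs] r2 eqs w3 res
      unfolding resid_def by blast
  qed
  have "eqs w1 w2 w3 \<and> w1 = w2 \<longleftrightarrow> w1 = w2 \<and> w3 + 1 / w3 + x\<^sup>2 - 3 = 0 \<and>
      (w2 = w3 \<or> w2 = (- (x - 3) * w3 + (x - 1)) / (x\<^sup>2 - 2 * x - 1))"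
    using c1 by metis
  moreover have "eqs w1 w2 w3 \<and> w3 = 1 \<longleftrightarrow> w3 = 1 \<and>
      (w1 = 1 \<and> w2 + 1 / w2 = - 2 * (x\<^sup>2 - 2) / x\<^sup>2 \<or> w1 + 1 / w1 = - 2 / x \<and> w2 = 1 / w1)"
    using c2 by metis
  moreover have "eqs w1 w2 w3 \<and> w3 = - (w1 * w2) \<longleftrightarrow> w3 = - (w1 * w2) \<and>
      (w1 + 1 / w1 = 2 * (x\<^sup>2 - 6) / (x\<^sup>2 - 4) \<and> w2 = -1 \<or> resid)"
    using c3 by metis
  moreover have "w3 = - (w1 * w2) \<and> w2 = -1 \<longleftrightarrow> w2 = -1 \<and> w3 = w1" by auto
  \<comment> \<open>Each component has been solved separately, and \<open>c4\<close> identifies the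
    residual solutions with (vi); the rest is propositional.\<close>
  ultimately have "type_II ?n W \<longleftrightarrow>
            (w1 = w2 \<and> w2 = w3 \<and> w3 + 1 / w3 + x^2 - 3 = 0)
          \<or> (w3 + 1 / w3 + x^2 - 3 = 0 \<and> w1 = w2 \<and>
              w2 = (- (x - 3) * w3 + (x - 1)) / (x^2 - 2 * x - 1))
          \<or> (w1 + 1 / w1 = 2 * (x^2 - 6) / (x^2 - 4) \<and> w2 = -1 \<and> w3 = w1)
          \<or> (w1 = 1 \<and> w3 = 1 \<and> w2 + 1 / w2 = - 2 * (x^2 - 2) / x^2)
          \<or> (w1 + 1 / w1 = - 2 / x \<and> w2 = 1 / w1 \<and> w3 = 1)
          \<or> case_vi"
    unfolding main c4[symmetric] by satx
  moreover have "case_vi \<longrightarrow> w1 * w2 = - w3" using c4 by auto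
  ultimately show ?thesis unfolding Let_def x_def by blast
qed

end
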